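(* Let $n\ge1$, $m\ge0$, $d=n+m$, and let $H\in\mathbb{Z}^{d\times n}$ be a matrix of rank $n$ in reduced Hermite normal form, with first $n$ rows $H_B$ and remaining $m$ rows $H_N$. Let $\Delta=\Delta(H)$, let $\delta=|\det(H_B)|$, and let $k$ be the number of diagonal elements of $H_B$ that are not equal to $1$. Then $$\|H_N\|_{\max}\le\frac{\Delta}{\delta}\Bigl(\frac{\delta}{2^{k-1}}+k-1\Bigr)\le\Delta.$$ Hence, $\|H\|_{\max}\le\Delta$.
   Context: $\|A\|_{\max}$ is the maximum absolute value of the entries of $A$. For an integer matrix $A$, $\Delta_k(A)$ is the greatest absolute value of the determinants of all $k\times k$ submatrices of $A$, and $\Delta(A)=\Delta_{\mathrm{rank}(A)}(A)$. Reduced Hermite normal form: write $H_B$ for the $n\times n$ matrix of the first $n$ rows of $H$ and $H_N$ for the $m\times n$ matrix of its remaining rows. $H$ is in reduced Hermite normal form if $H_B$ is non-singular and lower triangular, $0\le H_{ij}<H_{ii}$ for all $1\le j<i\le n$, and there is $s\in\{0,\dots,n\}$ with $H_{ii}=1$ for $i\le s$ and $H_{ii}\ge 2$ for $s<i\le n$ (so the first $s$ rows of $H_B$ are those of the identity matrix, and $k=n-s$). *)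

theory Defs
  imports
    "Jordan_Normal_Form.DL_Rank"
    "Jordan_Normal_Form.DL_Submatrix"
begin

text \<open>The maximum entry norm; a matrix without entries has norm 0.\<close>

definition max_norm :: "int mat \<Rightarrow> int" where
  "max_norm A = Max (insert 0 (abs ` elements_mat A))"

text \<open>The rank is taken over the rationals, because the rank of the library needs a field.\<close>

definition int_mat_rank :: "int mat \<Rightarrow> nat" where
  "int_mat_rank A = vec_space.rank (dim_row A) (map_mat rat_of_int A)"

text \<open>Only meaningful for \<open>k \<le> min (dim_row A) (dim_col A)\<close>; otherwise there are no
  \<open>k \<times> k\<close> submatrices and the maximum is over the empty set.\<close>

definition max_subdet :: "nat \<Rightarrow> int mat \<Rightarrow> int" where
  "max_subdet k A = Max {\<bar>det (submatrix A I J)\<bar> | I J.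
     I \<subseteq> {..<dim_row A} \<and> J \<subseteq> {..<dim_col A} \<and> card I = k \<and> card J = k}"

definition Delta :: "int mat \<Rightarrow> int" where
  "Delta A = max_subdet (int_mat_rank A) A"

text \<open>The split of \<open>H\<close> into its first \<open>n\<close> rows and the remaining ones, where \<open>n\<close> is the number
  of columns. The first block is only meaningful if \<open>H\<close> has at least \<open>n\<close> rows.\<close>

definition basis_block :: "int mat \<Rightarrow> int mat" where
  "basis_block H = mat (dim_col H) (dim_col H) (\<lambda>(i, j). H $$ (i, j))"

definition nonbasis_block :: "int mat \<Rightarrow> int mat" where
  "nonbasis_block H =
     mat (dim_row H - dim_col H) (dim_col H) (\<lambda>(i, j). H $$ (dim_col H + i, j))"

text \<open>Indices start at 0, so the first \<open>s\<close> diagonal elements are those with index \<open>i < s\<close>.\<close>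

definition reduced_hnf :: "int mat \<Rightarrow> bool" where
  "reduced_hnf H \<longleftrightarrow>
     (let n = dim_col H; B = basis_block H in
        n \<le> dim_row H \<and>
        det B \<noteq> 0 \<and>
        (\<forall>i j. i < j \<and> j < n \<longrightarrow> B $$ (i, j) = 0) \<and>
        (\<forall>i j. j < i \<and> i < n \<longrightarrow> 0 \<le> B $$ (i, j) \<and> B $$ (i, j) < B $$ (i, i)) \<and>
        (\<exists>s \<le> n. (\<forall>i < s. B $$ (i, i) = 1) \<and>
                 (\<forall>i. s \<le> i \<and> i < n \<longrightarrow> B $$ (i, i) \<ge> 2)))"

end

theory Submission
  imports Defs
begin

text \<open>Let \<open>y\<close> be a row of \<open>H_N\<close> and \<open>y = x H_B\<close>. By Cramer's rule \<open>x\<^sub>i det H_B\<close> is, up to sign,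
  the determinant of the submatrix of \<open>H\<close> in which row \<open>i\<close> of \<open>H_B\<close> is exchanged for \<open>y\<close>, so
  \<open>\<bar>x\<^sub>i\<bar> \<le> \<Delta> / \<delta>\<close>. As the entries of \<open>H_B\<close> below the diagonal are smaller than the diagonal
  entry \<open>h\<^sub>i\<close> of their row, each column of \<open>H_B\<close> has entry sum at most \<open>1 + \<Sum>\<^sub>i (h\<^sub>i - 1)\<close>. This is
  largest, given that the \<open>h\<^sub>i \<noteq> 1\<close> are at least \<open>2\<close> and have product \<open>\<delta>\<close>, if all but one of
  them are \<open>2\<close>.\<close>

section \<open>Submatrix determinants and the exchange of one row\<close>

lemma abs_det_submatrix_le_max_subdet:
  assumes "I \<subseteq> {..<dim_row A}" "J \<subseteq> {..<dim_col A}" "card I = k" "card J = k"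
  shows "\<bar>det (submatrix A I J)\<bar> \<le> max_subdet k A"
  unfolding max_subdet_def
proof (rule Max_ge)
  have "{\<bar>det (submatrix A I J)\<bar> | I J.
      I \<subseteq> {..<dim_row A} \<and> J \<subseteq> {..<dim_col A} \<and> card I = k \<and> card J = k}
    \<subseteq> (\<lambda>(I, J). \<bar>det (submatrix A I J)\<bar>) ` (Pow {..<dim_row A} \<times> Pow {..<dim_col A})"
    by auto
  then show "finite {\<bar>det (submatrix A I J)\<bar> | I J.
      I \<subseteq> {..<dim_row A} \<and> J \<subseteq> {..<dim_col A} \<and> card I = k \<and> card J = k}"
    by (rule finite_subset) simp
qed (use assms in auto)

lemma max_norm_le_iff:
  assumes "A \<in> carrier_mat r c" "0 \<le> b"
  shows "max_norm A \<le> b \<longleftrightarrow> (\<forall>i<r. \<forall>j<c. \<bar>A $$ (i, j)\<bar> \<le> b)"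
proof -
  have fin: "finite (insert 0 (abs ` elements_mat A))"
    by (simp add: elements_mat_def)
  have "max_norm A \<le> b \<longleftrightarrow> (\<forall>x \<in> elements_mat A. \<bar>x\<bar> \<le> b)"
    unfolding max_norm_def using assms(2) by (subst Max_le_iff[OF fin]) auto
  also have "\<dots> \<longleftrightarrow> (\<forall>i<r. \<forall>j<c. \<bar>A $$ (i, j)\<bar> \<le> b)"
    using assms(1) by (auto dest!: elements_matD intro!: elements_matI)
  finally show ?thesis .
qed

lemma pick_lessThan: "a < n \<Longrightarrow> pick {..<n} a = a"
  using pick_card_in_set[of a "{..<n}"]
  by (auto simp: Collect_conj_eq lessThan_def[symmetric] Int_absorb1 lessThan_subset_iff)

text \<open>\<open>submatrix\<close> keeps its rows in increasing order, so a row
  \<open>p \<ge> n\<close> that replaces row \<open>i\<close> comes last instead of in position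
  \<open>i\<close>, and the rows after \<open>i\<close> move up by one.\<close>

lemma pick_exchange:
  assumes "i < n" "n \<le> p"
  shows "pick (insert p ({..<n} - {i})) (n - 1) = p"
    and "a < n - 1 \<Longrightarrow> pick (insert p ({..<n} - {i})) a = (if a < i then a else Suc a)"
proof -
  let ?I = "insert p ({..<n} - {i})"
  have "{x \<in> ?I. x < p} = {..<n} - {i}"
    using assms by auto
  then have "card {x \<in> ?I. x < p} = n - 1"
    using assms by simp
  then show "pick ?I (n - 1) = p"
    using pick_card_in_set[of p ?I] by simp
  show "pick ?I a = (if a < i then a else Suc a)" if "a < n - 1"
  proof (cases "a < i")
    case True
    then have "{x \<in> ?I. x < a} = {..<a}"
      using assms by auto
    then show ?thesis
      using pick_card_in_set[of a ?I] True assms by simp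
  next
    case False
    then have "{x \<in> ?I. x < Suc a} = {..<Suc a} - {i}"
      using assms that by auto
    then have "card {x \<in> ?I. x < Suc a} = a"
      using False by simp
    then show ?thesis
      using pick_card_in_set[of "Suc a" ?I] False that assms by (simp add: less_diff_conv)
  qed
qed

text \<open>Up to sign, the sum is the determinant of the submatrix with row \<open>i\<close>
  exchanged for row \<open>p\<close>, expanded along its last row. That row has index
  \<open>n - 1\<close> instead of \<open>i\<close>, which changes every cofactor by the same
  sign.\<close>

lemma abs_exchange_det_le_max_subdet:
  assumes H: "H \<in> carrier_mat d n" and i: "i < n" and p: "n \<le> p" "p < d"
  shows "\<bar>\<Sum>j<n. H $$ (p, j) * cofactor (basis_block H) i j\<bar> \<le> max_subdet n H"
proof -
  let ?I = "insert p ({..<n} - {i})"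
  let ?S = "submatrix H ?I {..<n}"
  have card_I: "card ?I = n"
    using i p by (simp add: card_insert_if)
  have I: "{x. x < d \<and> x \<in> ?I} = ?I" and J: "{x. x < n \<and> x \<in> {..<n}} = {..<n}"
    using p by auto
  have S: "?S \<in> carrier_mat n n"
    using H card_I I J by (intro carrier_matI) (simp_all only: dim_submatrix carrier_matD card_lessThan)
  have entry: "?S $$ (a, b) = H $$ (pick ?I a, b)" if "a < n" "b < n" for a b
    using that H card_I I J
    by (subst submatrix_index) (simp_all only: carrier_matD card_lessThan pick_lessThan)
  \<comment> \<open>Without row \<open>p\<close>, the rows left are those of \<open>H_B\<close>
    other than row \<open>i\<close>, in their old order.\<close>
  have del: "mat_delete ?S (n - 1) j = mat_delete (basis_block H) i j" if "j < n" for j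
    using S H i p that
    by (intro eq_matI)
      (auto simp: mat_delete_def basis_block_def entry pick_exchange carrier_matD[OF S])
  have last: "n - 1 < n"
    using i by simp
  \<comment> \<open>The exponents on the two sides differ by the even number
    \<open>2 * a\<close>.\<close>
  have signs: "(- 1) ^ (l + b) = (- 1) ^ (l + a) * (- 1 :: int) ^ (a + b)" for l a b :: nat
  proof -
    have "(l + a) + (a + b) = (l + b) + 2 * a"
      by simp
    then show ?thesis
      by (simp only: power_add [symmetric]) (simp add: power_add power_mult)
  qed
  have sq: "\<bar>(- 1) ^ a * x\<bar> = \<bar>x\<bar>" for a and x :: int
    by (simp add: abs_mult power_abs)
  have "det ?S = (\<Sum>j<n. H $$ (p, j) * ((- 1) ^ (n - 1 + j) * det (mat_delete (basis_block H) i j)))"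
    unfolding laplace_expansion_row[OF S, OF last]
    using i p by (intro sum.cong) (auto simp: cofactor_def del entry pick_exchange simp del: One_nat_def)
  also have "\<dots> = (- 1) ^ (n - 1 + i) *
      (\<Sum>j<n. H $$ (p, j) * cofactor (basis_block H) i j)"
    unfolding sum_distrib_left cofactor_def
    by (intro sum.cong refl, subst signs[of "n - 1" _ i]) (simp only: mult.assoc mult.left_commute)
  finally have "\<bar>\<Sum>j<n. H $$ (p, j) * cofactor (basis_block H) i j\<bar> = \<bar>det ?S\<bar>"
    by (simp only: sq)
  moreover have "?I \<subseteq> {..<dim_row H}" "{..<n} \<subseteq> {..<dim_col H}"
    using H p by auto
  ultimately show ?thesis
    using abs_det_submatrix_le_max_subdet card_I by simp
qed

text \<open>This is \<open>y (adj B) B = (det B) y\<close> in column \<open>c\<close>. Without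
  division by \<open>det B\<close> it stays within the integers.\<close>

lemma cramer_row:
  fixes y :: "nat \<Rightarrow> 'a :: comm_ring_1"
  assumes B: "B \<in> carrier_mat n n" and c: "c < n"
  shows "y c * det B = (\<Sum>i<n. (\<Sum>j<n. y j * cofactor B i j) * B $$ (i, c))"
proof -
  have "(\<Sum>i<n. cofactor B i j * B $$ (i, c)) = (if j = c then det B else 0)" if "j < n" for j
  proof -
    have "(adj_mat B * B) $$ (j, c) = (det B \<cdot>\<^sub>m 1\<^sub>m n) $$ (j, c)"
      by (simp only: adj_mat[OF B])
    then show ?thesis
      using that c B adj_mat(1)[OF B]
      by (simp add: scalar_prod_def adj_mat_def lessThan_atLeast0 split: if_splits)
  qed
  then have "(\<Sum>j<n. y j * (\<Sum>i<n. cofactor B i j * B $$ (i, c)))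
      = (\<Sum>j<n. if j = c then y j * det B else 0)"
    by (intro sum.cong) auto
  moreover have "(\<Sum>i<n. (\<Sum>j<n. y j * cofactor B i j) * B $$ (i, c))
      = (\<Sum>j<n. y j * (\<Sum>i<n. cofactor B i j * B $$ (i, c)))"
    unfolding sum_distrib_left sum_distrib_right
    by (subst sum.swap) (simp add: mult.assoc)
  ultimately show ?thesis
    using c by simp
qed

text \<open>The second bound is attained if all factors but one are 2. Both bounds are proved in one
  induction, since the step for the second uses the first.\<close>

lemma sum_diff_one_le_prod:
  fixes a :: "'i \<Rightarrow> real"
  assumes "finite I" "\<And>i. i \<in> I \<Longrightarrow> 2 \<le> a i"
  shows "2 ^ card I \<le> prod a I"
    and "(\<Sum>i\<in>I. a i - 1) \<le> 2 * (prod a I / 2 ^ card I) + real (card I) - 2"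
proof -
  have "2 ^ card I \<le> prod a I \<and>
      (\<Sum>i\<in>I. a i - 1) \<le> 2 * (prod a I / 2 ^ card I) + real (card I) - 2"
    using assms
  proof (induction I rule: finite_induct)
    case empty
    then show ?case by simp
  next
    case (insert x I)
    define q where "q = prod a I / 2 ^ card I"
    have IH: "2 ^ card I \<le> prod a I" "(\<Sum>i\<in>I. a i - 1) \<le> 2 * q + real (card I) - 2"
      using insert by (auto simp: q_def)
    have "1 \<le> q"
      using IH(1) by (simp add: q_def)
    \<comment> \<open>Expanded, this is \<open>a x + 2 * q - 2 \<le> a x * q\<close>, the growth of
      the bound that the new summand requires.\<close>
    then have "0 \<le> (a x - 2) * (q - 1)"
      using insert.prems[of x] by simp
    moreover have "2 * (prod a (insert x I) / 2 ^ card (insert x I)) = a x * q"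
      using insert.hyps by (simp add: q_def)
    moreover have "2 * 2 ^ card I \<le> a x * prod a I"
      using IH(1) insert.prems[of x] by (intro mult_mono) auto
    ultimately show ?case
      using IH(2) insert.hyps by (simp add: algebra_simps)
  qed
  then show "2 ^ card I \<le> prod a I"
    and "(\<Sum>i\<in>I. a i - 1) \<le> 2 * (prod a I / 2 ^ card I) + real (card I) - 2"
    by auto
qed

theorem lemma1:
  fixes n m d k :: nat and H :: "int mat" and \<Delta> \<delta> :: int
  assumes "n \<ge> 1"
    and "d = n + m"
    and "H \<in> carrier_mat d n"
    and "int_mat_rank H = n"
    and "reduced_hnf H"
    and "\<Delta> = Delta H"
    and "\<delta> = \<bar>det (basis_block H)\<bar>"
    and "k = card {i. i < n \<and> basis_block H $$ (i, i) \<noteq> 1}"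
  shows "real_of_int (max_norm (nonbasis_block H))
           \<le> real_of_int \<Delta> / real_of_int \<delta>
              * (real_of_int \<delta> / 2 powi (int k - 1) + real k - 1)
       \<and> real_of_int \<Delta> / real_of_int \<delta>
              * (real_of_int \<delta> / 2 powi (int k - 1) + real k - 1)
           \<le> real_of_int \<Delta>
       \<and> max_norm H \<le> \<Delta>"
proof -

  \<comment> \<open>The diagonal of \<open>H_B\<close> and its product\<close>
  define B where "B = basis_block H"
  define h where "h i = B $$ (i, i)" for i
  define K where "K = {i. i < n \<and> h i \<noteq> 1}"
  define T where "T = real_of_int \<delta> / 2 powi (int k - 1) + real k - 1"
  note H = assms(3)
  have B: "B \<in> carrier_mat n n"
    using H by (simp add: B_def basis_block_def)
  have N: "nonbasis_block H \<in> carrier_mat m n"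
    using H assms(2) by (simp add: nonbasis_block_def)
  have B_H: "B $$ (i, j) = H $$ (i, j)" if "i < n" "j < n" for i j
    using that H by (simp add: B_def basis_block_def)
  have N_H: "nonbasis_block H $$ (i, j) = H $$ (n + i, j)" if "i < m" "j < n" for i j
    using that H assms(2) by (simp add: nonbasis_block_def)
  have \<Delta>: "\<Delta> = max_subdet n H"
    using assms by (simp add: Delta_def)
  have hnf: "B $$ (i, j) = 0" if "i < j" "j < n" for i j
    using assms(5) that H by (simp add: reduced_hnf_def B_def Let_def)
  have low: "0 \<le> B $$ (i, j)" "B $$ (i, j) < h i" if "j < i" "i < n" for i j
    using assms(5) that H by (simp_all add: reduced_hnf_def B_def h_def Let_def)
  obtain s where s: "\<And>i. i < s \<Longrightarrow> h i = 1" "\<And>i. s \<le> i \<Longrightarrow> i < n \<Longrightarrow> 2 \<le> h i"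
    using assms(5) carrier_matD(2)[OF H] unfolding reduced_hnf_def Let_def B_def h_def by blast
  have h1: "1 \<le> h i" if "i < n" for i
    using s[of i] that by (cases "i < s") auto
  have h2: "2 \<le> h i" if "i \<in> K" for i
    using h1[of i] that by (auto simp: K_def)
  have K: "finite K" "K \<subseteq> {..<n}" "k = card K"
    using assms(8) by (auto simp: K_def h_def B_def)
  have "det B = (\<Prod>i<n. h i)"
    using B det_lower_triangular[of n B, OF hnf B]
    by (simp add: prod_list_diag_prod h_def lessThan_atLeast0)
  moreover have prod_pos: "0 < (\<Prod>i<n. h i)"
    using h1 by (intro prod_pos) force
  ultimately have \<delta>_prod: "\<delta> = (\<Prod>i<n. h i)"
    using assms(7) by (simp add: B_def)
  then have \<delta>_pos: "0 < \<delta>"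
    using prod_pos by simp
  \<comment> \<open>Diagonal entries 1 contribute a factor 1 to the product and a summand 0 to the
    sum of the \<open>h i - 1\<close>, so both reduce to \<open>K\<close>.\<close>
  have \<delta>_K: "\<delta> = (\<Prod>i\<in>K. h i)"
    unfolding \<delta>_prod using K by (intro prod.mono_neutral_right) (auto simp: K_def)
  have sum_K: "(\<Sum>i<n. h i - 1) = (\<Sum>i\<in>K. h i - 1)"
    using K by (intro sum.mono_neutral_right) (auto simp: K_def)

  have "submatrix H {..<n} {..<n} = B"
  proof (rule eq_matI)
    have "{i. i < d \<and> i \<in> {..<n}} = {..<n}" "{i. i < n \<and> i \<in> {..<n}} = {..<n}"
      using assms(2) by auto
    then have c: "card {i. i < dim_row H \<and> i \<in> {..<n}} = n"
        "card {i. i < dim_col H \<and> i \<in> {..<n}} = n"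
      using H by auto
    then show "dim_row (submatrix H {..<n} {..<n}) = dim_row B"
        "dim_col (submatrix H {..<n} {..<n}) = dim_col B"
      using B by (simp_all only: dim_submatrix carrier_matD)
    show "submatrix H {..<n} {..<n} $$ (i, j) = B $$ (i, j)" if "i < dim_row B" "j < dim_col B" for i j
      using that B c by (subst submatrix_index) (simp_all add: pick_lessThan B_H)
  qed
  then have \<delta>_\<Delta>: "\<delta> \<le> \<Delta>"
    using abs_det_submatrix_le_max_subdet[of "{..<n}" H "{..<n}" n] H assms(2,7)
    by (simp add: \<Delta> B_def)

  \<comment> \<open>This form also covers \<open>k = 0\<close>, where the exponent is -1.\<close>
  have pow: "2 powi (int k - 1) = (2 :: real) ^ k / 2"
    by (simp add: power_int_diff)
  have prod_real: "(\<Prod>i\<in>K. real_of_int (h i)) = real_of_int \<delta>"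
    by (simp add: \<delta>_K)
  have K2: "2 \<le> real_of_int (h i)" if "i \<in> K" for i
    using h2[OF that] by simp
  have \<delta>_pow: "2 ^ k \<le> real_of_int \<delta>"
    using sum_diff_one_le_prod(1)[of K "\<lambda>i. real_of_int (h i)"] K K2 by (simp add: prod_real)
  have sum_T: "real_of_int (1 + (\<Sum>i<n. h i - 1)) \<le> T"
    using sum_diff_one_le_prod(2)[of K "\<lambda>i. real_of_int (h i)", folded K(3)] K(1) K2
    by (simp add: prod_real sum_K T_def pow mult.commute)
  have T_\<delta>: "T \<le> real_of_int \<delta>"
  proof (cases k)
    case 0
    then have "\<delta> = 1"
      using K by (simp add: \<delta>_K)
    then show ?thesis
      using 0 by (simp add: T_def)
  next
    case (Suc l)
    \<comment> \<open>Here \<open>T = 2 * q + l\<close> and \<open>\<delta> = 2 * q * 2 ^ l\<close>,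
      so the claim is \<open>l \<le> 2 * q * (2 ^ l - 1)\<close>. It follows from
      \<open>q \<ge> 1\<close> and \<open>l + 1 \<le> 2 ^ l\<close>.\<close>
    define q where "q = real_of_int \<delta> / 2 ^ k"
    have "1 \<le> q"
      using \<delta>_pow by (simp add: q_def)
    have "real (Suc l) \<le> real (2 ^ l)"
      by (simp only: of_nat_le_iff Suc_le_eq less_exp)
    then have "real l \<le> 2 * (2 ^ l - 1)"
      by simp
    also have "\<dots> \<le> 2 * q * (2 ^ l - 1)"
      using \<open>1 \<le> q\<close> by (intro mult_right_mono) auto
    also have "\<dots> = real_of_int \<delta> - 2 * q"
      by (simp add: q_def Suc field_simps)
    finally show ?thesis
      by (simp add: T_def pow Suc q_def)
  qed

  \<comment> \<open>Entries of \<open>H_N\<close>\<close>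
  have N_bound: "\<bar>H $$ (p, c)\<bar> * \<delta> \<le> \<Delta> * (1 + (\<Sum>i<n. h i - 1))"
    if p: "n \<le> p" "p < d" and c: "c < n" for p c
  proof -
    \<comment> \<open>\<open>D i\<close> is \<open>det B\<close> times the coefficient of row
      \<open>i\<close> of \<open>B\<close> in the expansion of row \<open>p\<close> of
      \<open>H\<close>.\<close>
    define D where "D i = (\<Sum>j<n. H $$ (p, j) * cofactor B i j)" for i
    have D: "\<bar>D i\<bar> \<le> \<Delta>" if "i < n" for i
      using abs_exchange_det_le_max_subdet[OF H that p] by (simp add: D_def \<Delta> B_def)
    \<comment> \<open>Below the diagonal, \<open>B $$ (i, c) < h i\<close> gives
      \<open>h i - 1\<close> by integrality; only the diagonal entry needs the extra 1.\<close>
    have col: "\<bar>B $$ (i, c)\<bar> \<le> (h i - 1) + (if i = c then 1 else 0)" if "i < n" for i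
      using hnf[of i c] low[of c i] h1[of i] that c
      by (cases i c rule: linorder_cases) (auto simp: h_def)
    have "\<bar>H $$ (p, c)\<bar> * \<delta> = \<bar>\<Sum>i<n. D i * B $$ (i, c)\<bar>"
      using cramer_row[OF B c, of "\<lambda>j. H $$ (p, j)"] assms(7)
      by (simp add: D_def B_def flip: abs_mult)
    also have "\<dots> \<le> (\<Sum>i<n. \<bar>D i\<bar> * \<bar>B $$ (i, c)\<bar>)"
      by (simp add: sum_abs flip: abs_mult)
    also have "\<dots> \<le> (\<Sum>i<n. \<Delta> * ((h i - 1) + (if i = c then 1 else 0)))"
      using D col \<delta>_pos \<delta>_\<Delta> by (intro sum_mono mult_mono) auto
    also have "\<dots> = \<Delta> * (1 + (\<Sum>i<n. h i - 1))"
      using c by (simp add: sum.distrib flip: sum_distrib_left)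
    finally show ?thesis .
  qed
  have N_real: "real_of_int \<bar>H $$ (p, c)\<bar> \<le> real_of_int \<Delta> / real_of_int \<delta> * T"
    if "n \<le> p" "p < d" "c < n" for p c
  proof -
    have "real_of_int \<bar>H $$ (p, c)\<bar> * real_of_int \<delta>
        \<le> real_of_int \<Delta> * real_of_int (1 + (\<Sum>i<n. h i - 1))"
      using N_bound[OF that] by (simp only: of_int_le_iff flip: of_int_mult)
    also have "\<dots> \<le> real_of_int \<Delta> * T"
      using sum_T \<delta>_pos \<delta>_\<Delta> by (intro mult_left_mono) auto
    finally show ?thesis
      using \<delta>_pos by (simp add: field_simps)
  qed
  have second: "real_of_int \<Delta> / real_of_int \<delta> * T \<le> real_of_int \<Delta>"
    using T_\<delta> \<delta>_pos \<delta>_\<Delta> by (simp add: divide_simps mult_left_mono)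

  \<comment> \<open>The norm is at least 0 even for \<open>m = 0\<close>, so the bound must be
    nonnegative by itself.\<close>
  have T_pos: "0 \<le> T"
  proof -
    have "0 \<le> (\<Sum>i<n. h i - 1)"
      by (intro sum_nonneg) (use h1 in force)
    then have "0 \<le> real_of_int (1 + (\<Sum>i<n. h i - 1))"
      by linarith
    then show ?thesis
      using sum_T by linarith
  qed
  \<comment> \<open>The norm is an integer, so the real bound may be replaced by its floor.\<close>
  have "max_norm (nonbasis_block H) \<le> \<lfloor>real_of_int \<Delta> / real_of_int \<delta> * T\<rfloor>"
    using T_pos \<delta>_pos \<delta>_\<Delta> assms(2) N_real by (subst max_norm_le_iff[OF N]) (auto simp: N_H le_floor_iff)
  then have first: "real_of_int (max_norm (nonbasis_block H)) \<le> real_of_int \<Delta> / real_of_int \<delta> * T"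
    by (simp add: le_floor_iff)

  have "\<bar>H $$ (i, j)\<bar> \<le> \<Delta>" if ij: "i < d" "j < n" for i j
  \<comment> \<open>Entries of \<open>H_B\<close> are at most the diagonal entry of their row, and
    that is at most \<open>\<delta>\<close> because the other diagonal factors are at least
    1.\<close>
  proof (cases "i < n")
    case True
    have "h i * 1 \<le> h i * (\<Prod>l\<in>{..<n} - {i}. h l)"
      using h1[OF True] by (intro mult_left_mono prod_ge_1) (use h1 in auto)
    also have "\<dots> = \<delta>"
      unfolding \<delta>_prod using True by (simp add: prod.remove)
    finally have "h i \<le> \<delta>"
      by simp
    moreover have "\<bar>B $$ (i, j)\<bar> \<le> h i"
      using hnf[of i j] low[of j i] h1[of i] True ij
      by (cases i j rule: linorder_cases) (auto simp: h_def)
    ultimately show ?thesis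
      using \<delta>_\<Delta> True ij by (simp add: B_H)
  next
    case False
    then have "real_of_int \<bar>H $$ (i, j)\<bar> \<le> real_of_int \<Delta>"
      using N_real[of i j] ij second by linarith
    then show ?thesis
      by (simp only: of_int_le_iff)
  qed
  then have "max_norm H \<le> \<Delta>"
    using \<delta>_pos \<delta>_\<Delta> by (subst max_norm_le_iff[OF H]) auto
  with first second show ?thesis
    by (simp add: T_def)
qed

end
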